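(* Let $\succ$ and $\succ_0$ be $0$-compatible weak order (WO) preference relations over the same relation schema. Then the preference relations $\succ\cup\succ_0$ and $\succ\otimes\succ_0$ are weak orders.
   Context: A relation schema $R(A_1,\dots,A_k)$ assigns each attribute $A_i$ a domain $U_i$, either a countably infinite set $D$ of uninterpreted constants or the set $\mathbb{Q}$ of rational numbers; tuples are elements of $U=U_1\times\cdots\times U_k$. A preference relation over $R$ is any subset of $U\times U$ (possibly infinite). A preference relation $\succ$ is a WO if it is irreflexive, transitive, and negatively transitive: for all $x,y,z$, $(x\not\succ y\wedge y\not\succ z)$ implies $x\not\succ z$. Union $\succ\cup\succ_0$ is set union; Pareto composition: $t_1(\succ\otimes\succ_0)t_2$ iff $(t_1\succ t_2\wedge t_2\not\succ_0 t_1)\vee(t_1\succ_0 t_2\wedge t_2\not\succ t_1)$. A $0$-conflict between $\succ$ and $\succ_0$ is a pair $(t_1,t_2)$ with $t_1\succ_0 t_2$ and $t_2\succ t_1$. The relations are $0$-compatible if there are no $0$-conflicts between them. *)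

theory Defs
  imports Complex_Main "HOL-Library.Countable_Set"
begin

datatype attr_domain = Uninterpreted | Rational

datatype 'd val = Const 'd | Rat rat

text \<open>
  The parameter \<open>D\<close> is the set of uninterpreted constants; it is required to be countably
  infinite where it is used.
\<close>

primrec domain_set :: "'d set \<Rightarrow> attr_domain \<Rightarrow> 'd val set" where
  "domain_set D Uninterpreted = Const ` D"
| "domain_set D Rational = range Rat"

text \<open>
  A schema \<open>R(A\<^sub>1, \<dots>, A\<^sub>k)\<close> is the list of its attribute names, each paired with its domain.
  A tuple is the list of its attribute values, in the order of the schema.
\<close>

type_synonym 'a schema = "('a \<times> attr_domain) list"

definition relation_schema :: "'a schema \<Rightarrow> bool" where
  "relation_schema R \<longleftrightarrow> R \<noteq> [] \<and> distinct (map fst R)"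

definition tuples :: "'d set \<Rightarrow> 'a schema \<Rightarrow> 'd val list set" where
  "tuples D R = listset (map (\<lambda>(A, d). domain_set D d) R)"

definition preference_relation :: "'t set \<Rightarrow> 't rel \<Rightarrow> bool" where
  "preference_relation U r \<longleftrightarrow> r \<subseteq> U \<times> U"

text \<open>
  The quantifiers are relative to \<open>U\<close>: over the whole type, negative transitivity
  would fail for every nonempty \<open>r \<subseteq> U \<times> U\<close> as soon as \<open>U\<close> is not the whole type.
\<close>

definition neg_trans_on :: "'t set \<Rightarrow> 't rel \<Rightarrow> bool" where
  "neg_trans_on U r \<longleftrightarrow>
     (\<forall>x\<in>U. \<forall>y\<in>U. \<forall>z\<in>U. (x, y) \<notin> r \<and> (y, z) \<notin> r \<longrightarrow> (x, z) \<notin> r)"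

definition weak_order :: "'t set \<Rightarrow> 't rel \<Rightarrow> bool" where
  "weak_order U r \<longleftrightarrow>
     preference_relation U r \<and> irrefl_on U r \<and> trans_on U r \<and> neg_trans_on U r"

definition pareto :: "'t rel \<Rightarrow> 't rel \<Rightarrow> 't rel" where
  "pareto r r0 = {(t1, t2). (t1, t2) \<in> r \<and> (t2, t1) \<notin> r0 \<or> (t1, t2) \<in> r0 \<and> (t2, t1) \<notin> r}"

definition zero_conflict :: "'t rel \<Rightarrow> 't rel \<Rightarrow> 't \<times> 't \<Rightarrow> bool" where
  "zero_conflict r r0 = (\<lambda>(t1, t2). (t1, t2) \<in> r0 \<and> (t2, t1) \<in> r)"

definition zero_compatible :: "'t rel \<Rightarrow> 't rel \<Rightarrow> bool" where
  "zero_compatible r r0 \<longleftrightarrow> (\<nexists>p. zero_conflict r r0 p)"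

end

theory Submission
  imports Defs
begin

text \<open>
  If \<open>x \<succ> y \<succ>\<^sub>0 z\<close>, negative transitivity of \<open>\<succ>\<close> gives \<open>x \<succ> z\<close> or \<open>z \<succ> y\<close>, and the latter
  would be a conflict with \<open>y \<succ>\<^sub>0 z\<close>; the other mixed case is symmetric, so the union is
  transitive. Compatibility also makes both side conditions of the Pareto composition vacuous,
  so it coincides with the union.
\<close>

lemma zero_compatible_iff: "zero_compatible r r0 \<longleftrightarrow> r0 \<inter> r\<inverse> = {}"
  by (auto simp: zero_compatible_def zero_conflict_def)

lemma zero_compatible_commute: "zero_compatible r r0 \<longleftrightarrow> zero_compatible r0 r"
  by (auto simp: zero_compatible_iff)

lemma pareto_eq_Un:
  assumes "zero_compatible r r0"
  shows "pareto r r0 = r \<union> r0"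
  using assms by (auto simp: zero_compatible_iff pareto_def)

text \<open>Contrapositive of negative transitivity. The endpoints lie in \<open>U\<close> because
  \<open>r\<close> is a preference relation, so membership is asked of \<open>y\<close>
  only.\<close>

lemma weak_order_cases:
  assumes "weak_order U r" "(x, z) \<in> r" "y \<in> U"
  shows "(x, y) \<in> r \<or> (y, z) \<in> r"
  using assms unfolding weak_order_def preference_relation_def neg_trans_on_def by blast

lemma zero_compatible_mixed_trans:
  assumes "weak_order U r" "weak_order U r0" "zero_compatible r r0"
    and "(x, y) \<in> r" "(y, z) \<in> r0"
  shows "(x, z) \<in> r"
proof -
  have "z \<in> U"
    using assms(2,5) by (auto simp: weak_order_def preference_relation_def)
  then have "(x, z) \<in> r \<or> (z, y) \<in> r"
    using weak_order_cases assms(1,4) by metis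
  then show ?thesis
    using assms(3,5) by (auto simp: zero_compatible_iff)
qed

lemma weak_order_Un:
  assumes r: "weak_order U r" and r0: "weak_order U r0" and "zero_compatible r r0"
  shows "weak_order U (r \<union> r0)"
proof -
  have "preference_relation U (r \<union> r0)" "irrefl_on U (r \<union> r0)"
    using r r0 by (auto simp: weak_order_def preference_relation_def irrefl_on_def)
  moreover have "trans_on U (r \<union> r0)"
  proof (rule trans_onI)
    fix x y z
    assume "x \<in> U" "y \<in> U" "z \<in> U" and "(x, y) \<in> r \<union> r0" "(y, z) \<in> r \<union> r0"
    moreover have "trans_on U r" "trans_on U r0"
      using r r0 by (auto simp: weak_order_def)
    \<comment> \<open>Allows the mixed case with the roles of \<open>r\<close> and \<open>r0\<close>
      exchanged: first step in \<open>r0\<close>, second in \<open>r\<close>.\<close>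
    moreover have "zero_compatible r0 r"
      using assms(3) zero_compatible_commute by blast
    ultimately show "(x, z) \<in> r \<union> r0"
      using zero_compatible_mixed_trans[OF assms] zero_compatible_mixed_trans[OF r0 r]
      by (blast dest: trans_onD)
  qed
  \<comment> \<open>By contraposition: for a pair in \<open>r\<close> or in \<open>r0\<close>, any
    intermediate point leaves one of the two steps in that same relation.\<close>
  moreover have "neg_trans_on U (r \<union> r0)"
    unfolding neg_trans_on_def
    using weak_order_cases[OF r] weak_order_cases[OF r0] by blast
  ultimately show ?thesis
    by (simp add: weak_order_def)
qed

theorem theorem5:
  fixes D :: "'d set" and R :: "'a schema" and succ succ0 :: "'d val list rel"
  assumes "countable D" and "infinite D"
    and "relation_schema R"
    and "weak_order (tuples D R) succ"
    and "weak_order (tuples D R) succ0"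
    and "zero_compatible succ succ0"
  shows "weak_order (tuples D R) (succ \<union> succ0) \<and> weak_order (tuples D R) (pareto succ succ0)"
  using weak_order_Un[OF assms(4-6)] by (simp add: pareto_eq_Un[OF assms(6)])

end
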